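(* The BFO rule solves the parity problem. That is, let $F:X_{odd}\to X_{odd}$ be the global rule of the BFO rule. For each $\mathbf{x}\in X_{odd}$ there exists a time step $t_0\ge 0$ such that for all $t\ge t_0$ the configuration $F^t(\mathbf{x})$ is homogeneous and consists of $1$s if $\mathrm{Par}(\mathbf{x})=1$, and consists of $0$s if $\mathrm{Par}(\mathbf{x})=0$.
   Context: For a positive integer $n$, $X_n=\{0,1\}^n$ is the set of configurations $\mathbf{x}=(x_0,\dots,x_{n-1})$ on a cyclic grid of $n$ cells; all indices are taken modulo $n$. $X_{odd}=\bigcup_{n\ge 1}X_{2n-1}$ is the set of all configurations of odd length. The homogeneous configurations are $(0,0,\dots,0)$ and $(1,1,\dots,1)$. The parity is $\mathrm{Par}(\mathbf{x})=x_0\oplus x_1\oplus\dots\oplus x_{n-1}$ (sum modulo 2). The BFO rule (corrected version) is the radius-4 local rule $f:\{0,1\}^9\to\{0,1\}$ defined by its active transitions: $f(x_{i-4},\dots,x_{i+4})=1-x_i$ if the 9-tuple $(x_{i-4},\dots,x_{i+4})$ matches at least one of the patterns $T_1,\dots,T_{12}$ below, and $f(x_{i-4},\dots,x_{i+4})=x_i$ otherwise. Each pattern lists 9 positions from left to right, the fifth (central, corresponding to $x_i$) position is in boldface, and $\bullet$ means "don't care": $T_1=[\bullet 1 1 1 \mathbf{0} 0 \bullet\bullet\bullet]$, $T_2=[1 1 1 0 \mathbf{0} \bullet\bullet\bullet\bullet]$, $T_3=[\bullet 0 0 1 \mathbf{0} 0 \bullet\bullet\bullet]$, $T_4=[0 0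 1 0 \mathbf{0} \bullet\bullet\bullet\bullet]$, $T_5=[\bullet\bullet\bullet 0 \mathbf{1} 1 0 \bullet\bullet]$, $T_6=[\bullet\bullet 0 1 \mathbf{1} 0 \bullet\bullet\bullet]$, $T_7=[\bullet 0 0 1 \mathbf{0} 1 0 \bullet\bullet]$, $T_8=[\bullet\bullet 0 0 \mathbf{1} 0 1 0 \bullet]$, $T_9=[\bullet\bullet\bullet 1 \mathbf{1} 1 0 1 \bullet]$, $T_{10}=[1 1 1 0 \mathbf{1} 0 \bullet\bullet\bullet]$, $T_{11}=[1 1 1 0 \mathbf{1} 1 1 \bullet\bullet]$, $T_{12}=[\bullet\bullet 1 1 \mathbf{1} 0 1 1 0]$. The global rule $F:X_{odd}\to X_{odd}$ is given by $F(\mathbf{x})_i=f(x_{i-4},x_{i-3},\dots,x_{i+4})$ with indices modulo the length of $\mathbf{x}$ (so $F$ preserves the length), and $F^t$ is its $t$-th iterate. *)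

theory Defs
  imports "HOL-Library.Z2"
begin

text \<open>A configuration is a list over the two-element field \<open>bit\<close>, so that \<open>+\<close> on cell
  states is exclusive or. Positions are numbered from 0.\<close>

type_synonym config = "bit list"

definition X :: "nat \<Rightarrow> config set" where
  "X n = {x. length x = n}"

definition X_odd :: "config set" where
  "X_odd = (\<Union>n\<in>{1..}. X (2 * n - 1))"

definition homogeneous :: "config \<Rightarrow> bool" where
  "homogeneous x \<longleftrightarrow> x = replicate (length x) 0 \<or> x = replicate (length x) 1"

definition Par :: "config \<Rightarrow> bit" where
  "Par x = (\<Sum>i<length x. x ! i)"

text \<open>The integer index is reduced modulo the length, so \<open>cell x (- 1)\<close> is the last cell.\<close>

definition cell :: "config \<Rightarrow> int \<Rightarrow> bit" where
  "cell x k = x ! nat (k mod int (length x))"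

text \<open>A pattern prescribes the states of a window of nine cells, centred at index 4;
  \<open>None\<close> is ``don't care''.\<close>

type_synonym pattern = "bit option list"

abbreviation (input) Z :: "bit option" where "Z \<equiv> Some 0"
abbreviation (input) I :: "bit option" where "I \<equiv> Some 1"
abbreviation (input) D :: "bit option" where "D \<equiv> None"

definition active_patterns :: "pattern set" where
  "active_patterns =
    {[D, I, I, I, Z, Z, D, D, D],
     [I, I, I, Z, Z, D, D, D, D],
     [D, Z, Z, I, Z, Z, D, D, D],
     [Z, Z, I, Z, Z, D, D, D, D],
     [D, D, D, Z, I, I, Z, D, D],
     [D, D, Z, I, I, Z, D, D, D],
     [D, Z, Z, I, Z, I, Z, D, D],
     [D, D, Z, Z, I, Z, I, Z, D],
     [D, D, D, I, I, I, Z, I, D],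
     [I, I, I, Z, I, Z, D, D, D],
     [I, I, I, Z, I, I, I, D, D],
     [D, D, I, I, I, Z, I, I, Z]}"

hide_const (open) Z I D

definition matches :: "bit list \<Rightarrow> pattern \<Rightarrow> bool" where
  "matches w p \<longleftrightarrow> list_all2 (\<lambda>b q. q = None \<or> q = Some b) w p"

definition f :: "bit list \<Rightarrow> bit" where
  "f w = (if \<exists>p\<in>active_patterns. matches w p then 1 - w ! 4 else w ! 4)"

definition F :: "config \<Rightarrow> config" where
  "F x = map (\<lambda>i. f (map (\<lambda>d. cell x (int i + d)) [-4..4])) [0..<length x]"

lemma length_F [simp]: "length (F x) = length x"
  by (simp add: F_def)

lemma X_odd_iff: "x \<in> X_odd \<longleftrightarrow> odd (length x)"
proof
  assume "odd (length x)"
  then obtain m where "length x = 2 * m + 1" by (rule oddE)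
  then have "x \<in> X (2 * Suc m - 1)" by (simp add: X_def)
  then show "x \<in> X_odd" unfolding X_odd_def by (metis UN_I atLeast_iff One_nat_def Suc_le_mono le0)
qed (auto simp: X_odd_def X_def)

lemma F_in_X_odd: "x \<in> X_odd \<Longrightarrow> F x \<in> X_odd"
  by (simp add: X_odd_iff)

end

theory Submission
  imports Defs
begin

text \<open>
  Call a 1 followed by a 0 a right end. Each right end carries a weight 0, 1 or 2 read off from its
  neighbourhood, and one step of the rule transports the weights by at most two cells without ever
  creating any. So the total weight is eventually constant, and from then on no word may occur
  that destroys weight.

  In this regime every gap of zeros has the same parity as the run of ones to its right. Otherwise
  the run on the left of the gap would first be eroded down to a single 1 if something is attached
  to its right end, then grow by two cells per step towards the next run, and finally produce a
  forbidden word. Hence consecutive right ends are at even distance, so that a cycle of odd length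
  has no right end at all and the configuration is homogeneous. The limit is determined by the
  parity, which is invariant because the flipped cells come in pairs.
\<close>

section \<open>The weight of right ends\<close>

type_synonym line = "int \<Rightarrow> bool"

text \<open>The disjuncts are the patterns \<open>T\<^sub>1, \<dots>, T\<^sub>1\<^sub>2\<close> in this order.\<close>

definition flips :: "line \<Rightarrow> int \<Rightarrow> bool" where
  "flips x i \<longleftrightarrow>
     x (i-3) \<and> x (i-2) \<and> x (i-1) \<and> \<not> x i \<and> \<not> x (i+1) \<or>
     x (i-4) \<and> x (i-3) \<and> x (i-2) \<and> \<not> x (i-1) \<and> \<not> x i \<or>
     \<not> x (i-3) \<and> \<not> x (i-2) \<and> x (i-1) \<and> \<not> x i \<and> \<not> x (i+1) \<or>
     \<not> x (i-4) \<and> \<not> x (i-3) \<and> x (i-2) \<and> \<not> x (i-1) \<and> \<not> x i \<or>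
     \<not> x (i-1) \<and> x i \<and> x (i+1) \<and> \<not> x (i+2) \<or>
     \<not> x (i-2) \<and> x (i-1) \<and> x i \<and> \<not> x (i+1) \<or>
     \<not> x (i-3) \<and> \<not> x (i-2) \<and> x (i-1) \<and> \<not> x i \<and> x (i+1) \<and> \<not> x (i+2) \<or>
     \<not> x (i-2) \<and> \<not> x (i-1) \<and> x i \<and> \<not> x (i+1) \<and> x (i+2) \<and> \<not> x (i+3) \<or>
     x (i-1) \<and> x i \<and> x (i+1) \<and> \<not> x (i+2) \<and> x (i+3) \<or>
     x (i-4) \<and> x (i-3) \<and> x (i-2) \<and> \<not> x (i-1) \<and> x i \<and> \<not> x (i+1) \<or>
     x (i-4) \<and> x (i-3) \<and> x (i-2) \<and> \<not> x (i-1) \<and> x i \<and> x (i+1) \<and> x (i+2) \<or>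
     x (i-2) \<and> x (i-1) \<and> x i \<and> \<not> x (i+1) \<and> x (i+2) \<and> x (i+3) \<and> \<not> x (i+4)"

definition G :: "line \<Rightarrow> line" where
  "G x i \<longleftrightarrow> (x i \<noteq> flips x i)"

text \<open>Read as words centred at \<open>p\<close>: 01100 weighs 1, 10100 weighs 0, any other
  right end 2. Values in \<open>nat\<close> ensure that the total cannot decrease forever.\<close>

definition weight :: "line \<Rightarrow> int \<Rightarrow> nat" where
  "weight x p =
    (if \<not> x p \<or> x (p+1) then 0
     else if \<not> x (p+2) \<and> x (p-1) \<and> \<not> x (p-2) then 1
     else if \<not> x (p+2) \<and> \<not> x (p-1) \<and> x (p-2) then 0
     else 2)"

text \<open>The weight of a right end moves two cells forward, two cells backward, or stays, according to
  the following two predicates. They are meant for right ends only, so \<open>x p\<close> and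
  \<open>\<not> x (p + 1)\<close> are not repeated.\<close>

definition fwd :: "line \<Rightarrow> int \<Rightarrow> bool" where
  "fwd x p \<longleftrightarrow>
     x (p-2) \<and> x (p-1) \<and> \<not> x (p+2) \<or>
     \<not> x (p-2) \<and> \<not> x (p-1) \<and> \<not> x (p+2) \<or>
     \<not> x (p-2) \<and> x (p-1) \<or>
     \<not> x (p-2) \<and> \<not> x (p-1) \<and> x (p+2) \<and> \<not> x (p+3) \<or>
     x (p-4) \<and> x (p-3) \<and> x (p-2) \<and> \<not> x (p-1) \<and> x (p+2)"

definition bwd :: "line \<Rightarrow> int \<Rightarrow> bool" where
  "bwd x p \<longleftrightarrow>
     x (p-2) \<and> x (p-1) \<and> x (p+2) \<and> \<not> (x (p-6) \<and> x (p-5) \<and> x (p-4) \<and> \<not> x (p-3)) \<or>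
     x (p-4) \<and> x (p-3) \<and> x (p-2) \<and> \<not> x (p-1) \<and> \<not> x (p+2)"

definition inflow :: "line \<Rightarrow> int \<Rightarrow> nat" where
  "inflow x j = (if fwd x (j-2) then weight x (j-2) else 0)
     + (if \<not> fwd x j \<and> \<not> bwd x j then weight x j else 0)
     + (if bwd x (j+2) then weight x (j+2) else 0)"

lemma bwd_not_fwd: "bwd x p \<Longrightarrow> x p \<Longrightarrow> \<not> x (p+1) \<Longrightarrow> \<not> fwd x p"
  unfolding fwd_def bwd_def by auto

text \<open>A finite check, since only boundedly many cells enter. At cell 0 all indices are
  numerals, which simplification can compare; \<open>shift\<close> carries the result to every
  cell.\<close>

lemma weight_G_le0: "weight (G x) 0 \<le> inflow x 0"
  apply (cases "x 0"; cases "x 1"; cases "x 2"; cases "x (-1)"; cases "x (-2)")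
  apply (simp_all (no_asm_simp) add: inflow_def weight_def fwd_def bwd_def G_def flips_def)
  done


section \<open>Translations and the words that destroy weight\<close>

definition shift :: "int \<Rightarrow> line \<Rightarrow> line" where
  "shift p x = (\<lambda>k. x (p + k))"

lemma G_shift: "G (shift p x) = shift p (G x)"
  by (rule ext) (simp add: G_def flips_def shift_def algebra_simps)

lemma weight_shift: "weight (shift p x) k = weight x (p + k)"
  by (simp add: weight_def shift_def algebra_simps)

lemma fwd_shift: "fwd (shift p x) k = fwd x (p + k)"
  by (simp add: fwd_def shift_def algebra_simps)

lemma bwd_shift: "bwd (shift p x) k = bwd x (p + k)"
  by (simp add: bwd_def shift_def algebra_simps)

lemma inflow_shift: "inflow (shift p x) k = inflow x (p + k)"
  by (simp add: inflow_def weight_shift fwd_shift bwd_shift algebra_simps)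

fun word_at :: "bool list \<Rightarrow> line \<Rightarrow> int \<Rightarrow> bool" where
  "word_at [] x i \<longleftrightarrow> True"
| "word_at (b # w) x i \<longleftrightarrow> x i = b \<and> word_at w x (i + 1)"

lemma word_at_shift: "word_at w (shift p x) i = word_at w x (p + i)"
  by (induction w arbitrary: i) (simp_all add: shift_def add.assoc)

text \<open>The offset of each word places the loss at cell 0. All later exclusions of words are
  derived from these twelve.\<close>

lemma local_strict:
  shows "word_at [False, True, True, False, False] x (-4) \<Longrightarrow> weight (G x) 0 < inflow x 0"
    and "word_at [False, False, True, False, True, False] x (-4) \<Longrightarrow> weight (G x) 0 < inflow x 0"
    and "word_at [False, True, True, False, True, True] x (-4) \<Longrightarrow> weight (G x) 0 < inflow x 0"
    and "word_at [True, True, True, False, False, True, False, False] x (-4) \<Longrightarrow> weight (G x) 0 < inflow x 0"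
    and "word_at [True, True, True, False, False, True, False, True, True] x (-4) \<Longrightarrow> weight (G x) 0 < inflow x 0"
    and "word_at [True, True, False, False, True, True, True] x (-3) \<Longrightarrow> weight (G x) 0 < inflow x 0"
    and "word_at [False, False, True, False, False, True, False, False] x (-4) \<Longrightarrow> weight (G x) 0 < inflow x 0"
    and "word_at [False, False, True, False, False, True, False, True, True] x (-4) \<Longrightarrow> weight (G x) 0 < inflow x 0"
    and "word_at [False, False, True, False, False, True, True, True] x (-4) \<Longrightarrow> weight (G x) 0 < inflow x 0"
    and "word_at [False, True, True, False, True, False, True] x (-4) \<Longrightarrow> weight (G x) 0 < inflow x 0"
    and "word_at [True, True, True, False, True, False, True, False, True] x (-6) \<Longrightarrow> weight (G x) 0 < inflow x 0"
    and "word_at [True, True, True, False, True, False, True, True] x (-6) \<Longrightarrow> weight (G x) 0 < inflow x 0"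
  by (cases "x 1"; cases "x 2"; cases "x (-1)"; cases "x (-2)"; cases "x 3"; simp add: inflow_def weight_def fwd_def bwd_def G_def flips_def)+

lemma weight_G_le: "weight (G x) j \<le> inflow x j"
  using weight_G_le0[of "shift j x"] by (simp add: G_shift weight_shift inflow_shift)

section \<open>Lines whose weight is conserved forever\<close>

text \<open>The odd period is what remains of the cyclic grid. Conservation is required at every
  cell and every time, so the property passes from \<open>x\<close> to \<open>G x\<close>.\<close>

definition good :: "line \<Rightarrow> bool" where
  "good x \<longleftrightarrow> (\<exists>n. odd n \<and> n > 0 \<and> shift n x = x)
     \<and> (\<forall>t j. weight ((G ^^ Suc t) x) j = inflow ((G ^^ t) x) j)"

lemma good_G:
  assumes "good x"
  shows "good (G x)"
proof -
  have "(G ^^ t) (G x) = (G ^^ Suc t) x" for t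
    by (simp only: funpow_Suc_right o_apply)
  moreover have "shift n (G x) = G x" if "shift n x = x" for n
    using that by (simp flip: G_shift)
  ultimately show ?thesis
    using assms unfolding good_def by (metis funpow_Suc_right o_apply)
qed

text \<open>A translation moves the occurrence to where its loss shows at cell 0, against
  conservation in the first step.\<close>

lemma good_avoid:
  assumes "\<And>y. word_at w y k \<Longrightarrow> weight (G y) 0 < inflow y 0" and "good x"
  shows "\<not> word_at w x i"
proof
  assume "word_at w x i"
  then have "word_at w (shift (i - k) x) k"
    by (simp add: word_at_shift)
  then have "weight (G (shift (i - k) x)) 0 < inflow (shift (i - k) x) 0"
    by (rule assms(1))
  moreover have "weight ((G ^^ Suc 0) x) (i - k) = inflow ((G ^^ 0) x) (i - k)"
    using assms(2) unfolding good_def by blast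
  ultimately show False
    by (simp add: G_shift weight_shift inflow_shift)
qed

lemma
  assumes "good x"
  shows no_01100: "\<not> word_at [False, True, True, False, False] x i"
    and no_001010: "\<not> word_at [False, False, True, False, True, False] x i"
    and no_011011: "\<not> word_at [False, True, True, False, True, True] x i"
    and no_11100100: "\<not> word_at [True, True, True, False, False, True, False, False] x i"
    and no_111001011: "\<not> word_at [True, True, True, False, False, True, False, True, True] x i"
    and no_1100111: "\<not> word_at [True, True, False, False, True, True, True] x i"
    and no_00100100: "\<not> word_at [False, False, True, False, False, True, False, False] x i"
    and no_001001011: "\<not> word_at [False, False, True, False, False, True, False, True, True] x i"
    and no_00100111: "\<not> word_at [False, False, True, False, False, True, True, True] x i"
    and no_0110101: "\<not> word_at [False, True, True, False, True, False, True] x i"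
    and no_111010101: "\<not> word_at [True, True, True, False, True, False, True, False, True] x i"
    and no_11101011: "\<not> word_at [True, True, True, False, True, False, True, True] x i"
  by (rule good_avoid[OF _ assms], erule local_strict)+

lemma good_period:
  assumes "good x"
  obtains n where "odd n" "n > 0" "\<And>i. x (i - n) = x i"
proof -
  obtain n where n: "odd n" "n > 0" "shift n x = x"
    using assms unfolding good_def by blast
  have "x (i - n) = x i" for i
    using fun_cong[OF n(3), of "i - n"] unfolding shift_def by simp
  with n show ?thesis
    using that by blast
qed

lemma good_recurs_left:
  assumes "good x"
  obtains z where "z < i" "x z = x i"
  using good_period[OF assms] by (metis diff_less_eq less_add_same_cancel1)

text \<open>An alternating segment loses weight only at its left end, so this word is excluded by
  extending it to the left until the odd period gives a contradiction.\<close>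

lemma no_1010101:
  assumes "good x"
  shows "\<not> word_at [True, False, True, False, True, False, True] x i"
proof
  let ?w = "[True, False, True, False, True, False, True]"
  assume *: "word_at ?w x i"
  have left: "word_at ?w x (j - 2)" if "word_at ?w x j" for j
    using that no_001010[OF assms, of "j - 2"] no_0110101[OF assms, of "j - 2"]
      no_111010101[OF assms, of "j - 2"]
    by (cases "x (j - 1)"; cases "x (j - 2)") (auto simp: algebra_simps)
  have alt: "word_at ?w x (i - 2 * int k)" for k
  proof (induction k)
    case (Suc k)
    then show ?case using left[of "i - 2 * int k"] by (simp add: algebra_simps del: word_at.simps)
  qed (use * in simp)
  obtain n where n: "odd n" "n > 0" "\<And>i. x (i - n) = x i"
    using good_period[OF assms] by blast
  then obtain k where k: "n = 2 * int k + 1"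
    using that[of "nat (n div 2)"] by simp
  have "x (i - n) = x i"
    by (rule n)
  \<comment> \<open>Cell \<open>i - n\<close> is the second letter, a 0, of the copy that starts at
    \<open>i - 2 * int (k + 1)\<close>.\<close>
  moreover have "\<not> x (i - n)"
    using alt[of "k + 1"] k by (simp add: algebra_simps)
  ultimately show False
    using * by simp
qed

text \<open>Each choice of the two cells on the left completes an excluded word.\<close>

lemma no_101011:
  assumes "good x"
  shows "\<not> word_at [True, False, True, False, True, True] x i"
  using no_001010[OF assms, of "i - 2"] no_0110101[OF assms, of "i - 2"]
    no_11101011[OF assms, of "i - 2"] no_1010101[OF assms, of "i - 2"]
  by (cases "x (i - 1)"; cases "x (i - 2)") (auto simp: algebra_simps)

lemma no_01010100:
  assumes "good x"
  shows "\<not> word_at [False, True, False, True, False, True, False, False] x i"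
  using no_001010[OF assms, of "i - 1"] no_1010101[OF assms, of "i - 1"]
  by (cases "x (i - 1)") (auto simp: algebra_simps)

section \<open>The evolution of runs\<close>

definition ones :: "line \<Rightarrow> int \<Rightarrow> int \<Rightarrow> bool" where
  "ones x a b \<longleftrightarrow> (\<forall>k. a \<le> k \<and> k < b \<longrightarrow> x k)"

definition zeros :: "line \<Rightarrow> int \<Rightarrow> int \<Rightarrow> bool" where
  "zeros x a b \<longleftrightarrow> (\<forall>k. a \<le> k \<and> k < b \<longrightarrow> \<not> x k)"

text \<open>Only the right boundary is fixed, so the tail of a longer run also counts; conditions on
  the cells before \<open>l\<close> are stated where they matter.\<close>

definition run :: "line \<Rightarrow> int \<Rightarrow> int \<Rightarrow> bool" where
  "run x l m \<longleftrightarrow> 0 < m \<and> ones x l (l + m) \<and> \<not> x (l + m)"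

lemma ones_Cons: "x a \<Longrightarrow> ones x (a + 1) b \<Longrightarrow> ones x a b"
  unfolding ones_def by (metis add1_zle_eq less_le)

lemma zeros_Cons: "\<not> x a \<Longrightarrow> zeros x (a + 1) b \<Longrightarrow> zeros x a b"
  unfolding zeros_def by (metis add1_zle_eq less_le)

text \<open>Every pattern with centre 0 requires a 1 in one of the two cells to its left.\<close>

lemma G_zero: "\<not> x i \<Longrightarrow> \<not> x (i - 1) \<Longrightarrow> \<not> x (i - 2) \<Longrightarrow> \<not> G x i"
  by (simp add: G_def flips_def)

lemma G_one: "x i \<Longrightarrow> x (i - 1) \<Longrightarrow> x (i + 1) \<Longrightarrow> x (i + 2) \<Longrightarrow> G x i"
  by (simp add: G_def flips_def)

lemma nearest_left:
  fixes q :: int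
  assumes "P z" "z < q"
  obtains y where "z \<le> y" "y < q" "P y" "\<And>k. y < k \<Longrightarrow> k < q \<Longrightarrow> \<not> P k"
proof -
  define A where "A = {z..<q} \<inter> Collect P"
  have A: "finite A" "z \<in> A"
    using assms by (simp_all add: A_def)
  then have y: "Max A \<in> A"
    by (intro Max_in) auto
  have "\<not> P k" if "Max A < k" "k < q" for k
  proof
    assume "P k"
    with that y have "k \<in> A"
      by (simp add: A_def)
    then have "k \<le> Max A"
      using A by simp
    with that show False by simp
  qed
  moreover have "z \<le> Max A" "Max A < q" "P (Max A)"
    using y by (simp_all add: A_def)
  ultimately show ?thesis
    using that by blast
qed

text \<open>The right end retreats two cells before a single 0 (\<open>T\<^sub>9\<close>) and
  otherwise advances two cells (\<open>T\<^sub>1\<close>, \<open>T\<^sub>2\<close>). Cell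
  \<open>l\<close> is left out because its fate depends on the cells to its left.\<close>

lemma run_tail_step:
  assumes "good x" "run x l m" "m \<ge> 3"
  obtains m' where "m' = m + 2 \<or> m' = m - 2" "ones (G x) (l + 1) (l + m')" "\<not> G x (l + m')"
proof -
  define r where "r = l + m"
  have one: "x k" if "l \<le> k" "k < r" for k
    using assms(2) that by (simp add: run_def ones_def r_def)
  have r: "x (r - 3)" "x (r - 2)" "x (r - 1)" "\<not> x r"
    using one assms by (auto simp: r_def run_def)
  have inner: "G x k" if "l + 1 \<le> k" "k < r - 2" for k
    using that by (intro G_one one) auto
  show ?thesis
  proof (cases "x (r + 1)")
    case True
    have "\<not> G x (r - 2)"
      using r True by (simp add: G_def flips_def algebra_simps)
    with inner show ?thesis
      by (intro that[of "m - 2"]) (auto simp: ones_def r_def algebra_simps)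
  next
    case False
    have "G x (r - 2)" "G x (r - 1)" "G x r" "G x (r + 1)"
      using r False by (simp_all add: G_def flips_def algebra_simps)
    moreover have "k = r - 2 \<or> k = r - 1 \<or> k = r \<or> k = r + 1" if "r - 2 \<le> k" "k < r + 2" for k
      using that by presburger
    ultimately have "ones (G x) (l + 1) (r + 2)"
      unfolding ones_def using inner by (metis linorder_not_less)
    \<comment> \<open>The advance stops exactly here: a further 1 would require an excluded
      word.\<close>
    moreover have "\<not> G x (r + 2)"
      using r False no_01100[OF assms(1)] no_11100100[OF assms(1), of "r - 3"]
        no_111001011[OF assms(1), of "r - 3"] no_001010[OF assms(1), of r]
        no_1100111[OF assms(1), of "r - 2"]
      by (cases "x (r + 2)"; cases "x (r + 3)"; cases "x (r + 4)"; cases "x (r + 5)")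
         (auto simp: G_def flips_def algebra_simps)
    ultimately show ?thesis
      by (intro that[of "m + 2"]) (auto simp: r_def algebra_simps)
  qed
qed

text \<open>The last hypothesis rules out a run of exactly two ones, which \<open>T\<^sub>5\<close>
  would attack; \<open>T\<^sub>8\<close> would need the excluded word 001010.\<close>

lemma one_after_gap_stays:
  assumes "good x" "\<not> x (l - 2)" "\<not> x (l - 1)" "x l" "x (l + 1) \<Longrightarrow> x (l + 2)"
  shows "G x l"
  using assms no_001010[OF assms(1), of "l - 2"]
  by (cases "x (l + 1)") (auto simp: G_def flips_def algebra_simps)

text \<open>The parity of the length is preserved; with \<open>run1_step\<close> this covers all
  runs except those of length 2.\<close>

lemma run_step:
  assumes "good x" "run x l m" "m \<ge> 3" "\<not> x (l - 2)" "\<not> x (l - 1)"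
  obtains m' where "m' = m + 2 \<or> m' = m - 2" "run (G x) l m'"
proof -
  obtain m' where m': "m' = m + 2 \<or> m' = m - 2" "ones (G x) (l + 1) (l + m')" "\<not> G x (l + m')"
    using run_tail_step[OF assms(1-3)] .
  have "x l" "x (l + 2)"
    using assms(2,3) by (auto simp: run_def ones_def)
  then have "G x l"
    using one_after_gap_stays[OF assms(1,4,5)] by simp
  then have "run (G x) l m'"
    using m' assms(3) ones_Cons unfolding run_def by auto
  with m'(1) show ?thesis
    using that by blast
qed

lemma run1_step:
  assumes "good x" "run x l 1" "\<not> x (l - 2)" "\<not> x (l - 1)"
  obtains m' where "m' = 1 \<or> m' = 3" "run (G x) l m'"
proof -
  have x: "x l" "\<not> x (l + 1)"
    using assms(2) by (auto simp: run_def ones_def)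
  have Gl: "G x l"
    using one_after_gap_stays[OF assms(1,3,4)] x by simp
  show ?thesis
  proof (cases "x (l + 2)")
    case True
    have "\<not> G x (l + 1)"
      using x True assms(3,4) no_001010[OF assms(1), of "l - 2"]
      by (auto simp: G_def flips_def algebra_simps)
    with Gl show ?thesis
      by (intro that[of 1]) (auto simp: run_def ones_def order_antisym_conv zless_add1_eq)
  next
    case False
    have "G x (l + 1)" "G x (l + 2)"
      using x False assms(3,4) by (auto simp: G_def flips_def algebra_simps)
    moreover have "k = l \<or> k = l + 1 \<or> k = l + 2" if "l \<le> k" "k < l + 3" for k
      using that by presburger
    ultimately have "ones (G x) l (l + 3)"
      unfolding ones_def using Gl by metis
    moreover have "\<not> G x (l + 3)"
      using x False assms(3,4) no_00100100[OF assms(1), of "l - 2"]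
        no_001001011[OF assms(1), of "l - 2"] no_001010[OF assms(1), of "l + 1"]
        no_00100111[OF assms(1), of "l - 2"]
      by (cases "x (l + 3)"; cases "x (l + 4)"; cases "x (l + 5)"; cases "x (l + 6)")
         (auto simp: G_def flips_def algebra_simps)
    ultimately show ?thesis
      by (intro that[of 3]) (auto simp: run_def)
  qed
qed

text \<open>Since 01100, 011011 and 0110101 are excluded, only the continuation 110100 is
  left.\<close>

lemma run2_context:
  assumes "good x" "run x l 2" "\<not> x (l - 1)"
  shows "x l" "x (l + 1)" "\<not> x (l + 2)" "x (l + 3)" "\<not> x (l + 4)" "\<not> x (l + 5)"
proof -
  show x: "x l" "x (l + 1)" "\<not> x (l + 2)"
    using assms(2) by (auto simp: run_def ones_def)
  show x3: "x (l + 3)"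
    using x assms(3) no_01100[OF assms(1), of "l - 1"] by (auto simp: algebra_simps)
  show x4: "\<not> x (l + 4)"
    using x x3 assms(3) no_011011[OF assms(1), of "l - 1"] by (auto simp: algebra_simps)
  show "\<not> x (l + 5)"
    using x x3 x4 assms(3) no_0110101[OF assms(1), of "l - 1"] by (auto simp: algebra_simps)
qed

text \<open>\<open>T\<^sub>5\<close> and \<open>T\<^sub>6\<close> erase both ones while the single 1
  behind them stays. The gap in front then ends 3 cells later, with the other parity.\<close>

lemma run2_step:
  assumes "good x" "run x l 2" "\<not> x (l - 1)"
  shows "zeros (G x) l (l + 3)" "run (G x) (l + 3) 1"
proof -
  note c = run2_context[OF assms]
  have G: "\<not> G x l" "\<not> G x (l + 1)" "\<not> G x (l + 2)" "G x (l + 3)" "\<not> G x (l + 4)"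
    using c assms(3) by (auto simp: G_def flips_def algebra_simps)
  have "k = l \<or> k = l + 1 \<or> k = l + 2" if "l \<le> k" "k < l + 3" for k
    using that by presburger
  with G show "zeros (G x) l (l + 3)"
    unfolding zeros_def by blast
  have "k = l + 3" if "l + 3 \<le> k" "k < l + 3 + 1" for k
    using that by presburger
  with G(4) have "ones (G x) (l + 3) (l + 3 + 1)"
    unfolding ones_def by metis
  then show "run (G x) (l + 3) 1"
    using G(5) by (simp add: run_def add.assoc)
qed

lemma G_grow:
  assumes "x (p - 2) \<and> x (p - 1) \<or> \<not> x (p - 2) \<and> \<not> x (p - 1)" "x p" "\<not> x (p + 1)" "\<not> x (p + 2)"
  shows "G x p" "G x (p + 1)" "G x (p + 2)"
  using assms by (auto simp: G_def flips_def algebra_simps)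

text \<open>The first two zeros are given up because a run on their left may grow into them.\<close>

lemma zeros_G:
  assumes "zeros x a b" "zeros (G x) b c"
  shows "zeros (G x) (a + 2) c"
  unfolding zeros_def
proof (intro allI impI)
  fix k assume k: "a + 2 \<le> k \<and> k < c"
  show "\<not> G x k"
  proof (cases "k < b")
    case True
    then show ?thesis
      using assms(1) k by (intro G_zero) (auto simp: zeros_def)
  next
    case False
    then show ?thesis
      using assms(2) k by (auto simp: zeros_def)
  qed
qed

text \<open>\<open>T b l\<close> describes what may follow a gap that ends before \<open>l\<close>, where \<open>b\<close> says that the gap is
  even. A target may move right by 3 once, when a run of two ones next to a single 1 vanishes, and
  this turns an odd gap into an even one. Hence the summand 4 for odd gaps in the induction measure
  of the growing phase.\<close>

lemma target_blocked:
  fixes T :: "bool \<Rightarrow> int \<Rightarrow> line \<Rightarrow> bool"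
  assumes step: "\<And>b l x. good x \<Longrightarrow> \<not> x (l - 2) \<Longrightarrow> \<not> x (l - 1) \<Longrightarrow> T b l x \<Longrightarrow>
      \<exists>j. (j = 0 \<or> j = 3 \<and> \<not> b) \<and> zeros (G x) l (l + j) \<and> T (b \<longleftrightarrow> even j) (l + j) (G x)"
    and near1: "\<And>p x. good x \<Longrightarrow> x (p - 2) \<Longrightarrow> x (p - 1) \<Longrightarrow> x p \<Longrightarrow> \<not> x (p + 1) \<Longrightarrow>
      T False (p + 2) x \<Longrightarrow> False"
    and near2: "\<And>p x. good x \<Longrightarrow> x (p - 2) = x (p - 1) \<Longrightarrow> x p \<Longrightarrow> \<not> x (p + 1) \<Longrightarrow> \<not> x (p + 2) \<Longrightarrow>
      T True (p + 3) x \<Longrightarrow> False"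
    and "good x" "x p" "zeros x (p + 1) l" "p + 3 \<le> l" "T (odd (l - p)) l x"
  shows False
proof -
  have step': "\<exists>l'. (l' = l \<or> l' = l + 3 \<and> even (l - p)) \<and> zeros (G x) (p + 3) l' \<and> T (odd (l' - p)) l' (G x)"
    if "good x" "zeros x (p + 1) l" "p + 3 \<le> l" "T (odd (l - p)) l x" for x p l
  proof -
    note h = that
    have "\<not> x (l - 2)" "\<not> x (l - 1)"
      using that(2,3) by (auto simp: zeros_def)
    then obtain j where j: "j = 0 \<or> j = 3 \<and> even (l - p)" "zeros (G x) l (l + j)"
        "T (odd (l - p) \<longleftrightarrow> even j) (l + j) (G x)"
      using step[OF h(1) _ _ h(4)] by auto
    have "zeros (G x) (p + 3) (l + j)"
      using zeros_G[OF h(2) j(2)] by (simp add: add.assoc)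
    moreover have "(odd (l - p) \<longleftrightarrow> even j) \<longleftrightarrow> odd (l + j - p)"
      by auto
    ultimately show ?thesis
      using j by (intro exI[of _ "l + j"]) auto
  qed
  \<comment> \<open>A run of at least three ones gains two cells per step, until
    \<open>near1\<close> or \<open>near2\<close> applies.\<close>
  have growing: False
    if "good x" "x (p - 2)" "x (p - 1)" "x p" "zeros x (p + 1) l" "p + 2 \<le> l" "T (odd (l - p)) l x" for x p l
    using that
  proof (induction "nat (l - p + (if even (l - p) then 4 else 0))" arbitrary: x p l rule: less_induct)
    case less
    have z: "\<not> x (p + 1)" "p + 3 \<le> l \<Longrightarrow> \<not> x (p + 2)"
      using less.prems by (auto simp: zeros_def)
    consider "l = p + 2" | "l = p + 3" | "p + 4 \<le> l"
      using less.prems(6) by linarith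
    then show False
    proof cases
      case 1
      then show False using near1[of x p] less.prems z by simp
    next
      case 2
      then show False using near2[of x p] less.prems z by simp
    next
      case 3
      obtain l' where l': "l' = l \<or> l' = l + 3 \<and> even (l - p)" "zeros (G x) (p + 3) l'"
          "T (odd (l' - p)) l' (G x)"
        using step'[of x p l] less.prems 3 by auto
      have "G x p" "G x (p + 1)" "G x (p + 2)"
        using G_grow[of x p] less.prems z 3 by auto
      then show False
        using l' 3 less.prems(1)
        by (intro less.hyps[of l' "p + 2" "G x"]) (auto simp: good_G algebra_simps)
    qed
  qed
  \<comment> \<open>An isolated 1 becomes a run of three ones by \<open>T\<^sub>3\<close> and
    \<open>T\<^sub>4\<close>, unless \<open>near2\<close> applies at once.\<close>
  have single: False
    if "good x" "\<not> x (p - 2)" "\<not> x (p - 1)" "x p" "zeros x (p + 1) l" "p + 3 \<le> l" "T (odd (l - p)) l x" for x p l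
  proof -
    note h = that
    have z: "\<not> x (p + 1)" "\<not> x (p + 2)"
      using h by (auto simp: zeros_def)
    show False
    proof (cases "l = p + 3")
      case True
      then show False using near2[of x p] h z by simp
    next
      case False
      obtain l' where l': "l' = l \<or> l' = l + 3 \<and> even (l - p)" "zeros (G x) (p + 3) l'"
          "T (odd (l' - p)) l' (G x)"
        using step'[of x p l] h by auto
      have "G x p" "G x (p + 1)" "G x (p + 2)"
        using G_grow[of x p] h z by auto
      then show False
        using l' h(1,6) False by (intro growing[of "G x" "p + 2" l']) (auto simp: good_G algebra_simps)
    qed
  qed
  \<comment> \<open>Excluded words force 111 at \<open>p - 6\<close>; then \<open>T\<^sub>10\<close>
    erases the 1 at \<open>p - 2\<close> and leaves the one at \<open>p\<close> isolated.\<close>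
  have bound_single: False
    if "good x" "\<not> x (p - 3)" "x (p - 2)" "\<not> x (p - 1)" "x p" "zeros x (p + 1) l" "p + 3 \<le> l"
      "T (odd (l - p)) l x" for x p l
  proof -
    note h = that
    have z: "\<not> x (p + 1)" "\<not> x (p + 2)"
      using h by (auto simp: zeros_def)
    have x4: "x (p - 4)"
      using no_001010[OF h(1), of "p - 4"] h z by (auto simp: algebra_simps)
    have x5: "x (p - 5)"
      using no_01010100[OF h(1), of "p - 5"] h z x4 by (auto simp: algebra_simps)
    have x6: "x (p - 6)"
      using no_0110101[OF h(1), of "p - 6"] h x4 x5 by (auto simp: algebra_simps)
    obtain l' where l': "l' = l \<or> l' = l + 3 \<and> even (l - p)" "zeros (G x) (p + 3) l'"
        "T (odd (l' - p)) l' (G x)"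
      using step'[of x p l] h by auto
    have G: "\<not> G x (p - 2)" "\<not> G x (p - 1)" "G x p" "\<not> G x (p + 1)" "\<not> G x (p + 2)"
      using h z x4 x5 x6 by (auto simp: G_def flips_def algebra_simps)
    have "zeros (G x) (p + 1) l'"
      using G l'(2) zeros_Cons[of "G x" "p + 1" l'] zeros_Cons[of "G x" "p + 2" l'] by (simp add: add.assoc)
    then show False
      using l' h(1,7) G by (intro single[of "G x" p l']) (auto simp: good_G algebra_simps)
  qed
  \<comment> \<open>A 1 is attached to a run of at least two ones. A run of two vanishes and
    isolates \<open>p\<close>; from a longer one \<open>T\<^sub>9\<close> and
    \<open>T\<^sub>10\<close> move the right end to \<open>p - 2\<close>, which preserves the parity
    of the gap.\<close>
  have composite: False
    if "good x" "\<not> x z" "z < p - 3" "ones x (z + 1) (p - 1)" "\<not> x (p - 1)" "x p"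
      "zeros x (p + 1) l" "p + 3 \<le> l" "T (odd (l - p)) l x" for x p l z
    using that
  proof (induction "nat (p - z)" arbitrary: x p l z rule: less_induct)
    case less
    have z: "\<not> x (p + 1)" "\<not> x (p + 2)"
      using less.prems by (auto simp: zeros_def)
    have o: "x k" if "z < k" "k < p - 1" for k
      using less.prems(4) that by (auto simp: ones_def)
    have o23: "x (p - 2)" "x (p - 3)"
      using o less.prems(3) by auto
    obtain l' where l': "l' = l \<or> l' = l + 3 \<and> even (l - p)" "zeros (G x) (p + 3) l'"
        "T (odd (l' - p)) l' (G x)"
      using step'[of x p l] less.prems by auto
    show False
    proof (cases "z = p - 4")
      case True
      have G: "\<not> G x (p - 2)" "\<not> G x (p - 1)" "G x p" "\<not> G x (p + 1)" "\<not> G x (p + 2)"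
        using less.prems z o23 True by (auto simp: G_def flips_def algebra_simps)
      have "zeros (G x) (p + 1) l'"
        using G l'(2) zeros_Cons[of "G x" "p + 1" l'] zeros_Cons[of "G x" "p + 2" l'] by (simp add: add.assoc)
      then show False
        using l' less.prems(1,8) G by (intro single[of "G x" p l']) (auto simp: good_G algebra_simps)
    next
      case False
      have o4: "x (p - 4)"
        using o less.prems(3) False by auto
      have G: "\<not> G x (p - 3)" "G x (p - 2)" "\<not> G x (p - 1)" "\<not> G x p" "\<not> G x (p + 1)" "\<not> G x (p + 2)"
        using less.prems(5,6) z o23 o4 by (auto simp: G_def flips_def algebra_simps)
      have zl: "zeros (G x) (p - 2 + 1) l'"
        using G l'(2) zeros_Cons[of "G x" "p + 1" l'] zeros_Cons[of "G x" "p + 2" l']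
          zeros_Cons[of "G x" p l'] zeros_Cons[of "G x" "p - 1" l'] by (simp add: add.assoc)
      have Tl: "T (odd (l' - (p - 2))) l' (G x)"
        using l'(3) by simp
      \<comment> \<open>The 0 before the run persists, so the next \<open>z'\<close> is at least
        \<open>z\<close> and the measure falls.\<close>
      have Gz: "\<not> G x z"
      proof -
        have "x (z + 1)" "x (z + 2)" "x (z + 3)"
          using o less.prems(3) False by auto
        then show ?thesis
          using less.prems(2) no_1100111[OF less.prems(1), of "z - 3"] no_00100111[OF less.prems(1), of "z - 4"]
          by (auto simp: G_def flips_def algebra_simps)
      qed
      show False
      proof (cases "G x (p - 4)")
        case G4: False
        show False
          using single[of "G x" "p - 2" l'] zl Tl l'(1) less.prems(1,8) G G4 by (auto simp: good_G algebra_simps)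
      next
        case G4: True
        show False
        proof (cases "G x (p - 5)")
          case G5: False
          show False
            using bound_single[of "G x" "p - 2" l'] zl Tl l'(1) less.prems(1,8) G G4 G5 by (auto simp: good_G algebra_simps)
        next
          case G5: True
          have "z < p - 5"
            using Gz G5 less.prems(3) False by (cases "z = p - 5") auto
          then obtain z' where z': "z \<le> z'" "z' < p - 5" "\<not> G x z'" "\<And>k. z' < k \<Longrightarrow> k < p - 5 \<Longrightarrow> G x k"
            using nearest_left[of "\<lambda>k. \<not> G x k" z "p - 5"] Gz by metis
          have "k = p - 5 \<or> k = p - 4 \<or> k < p - 5" if "k < p - 3" for k
            using that by presburger
          then have "ones (G x) (z' + 1) (p - 2 - 1)"
            using z'(4) G4 G5 unfolding ones_def by (auto simp: add1_zle_eq)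
          then show False
            using zl Tl l'(1) less.prems(1,3,8) G z'
            by (intro less.hyps[of "p - 2" z' "G x" l']) (auto simp: good_G algebra_simps)
        qed
      qed
    qed
  qed
  have z: "\<not> x (p + 1)" "\<not> x (p + 2)"
    using assms(6,7) by (auto simp: zeros_def)
  \<comment> \<open>The cells to the left of \<open>p\<close> decide which of the four situations
    holds at the start.\<close>
  show False
  proof (cases "x (p - 1)")
    case True
    then have "x (p - 2)"
      using no_01100[OF \<open>good x\<close>, of "p - 2"] \<open>x p\<close> z by (auto simp: algebra_simps)
    then show False
      using growing[of x p l] assms(4-) True by simp
  next
    case x1: False
    show False
    proof (cases "x (p - 2)")
      case False
      then show False
        using single[of x p l] assms(4-) x1 by simp
    next
      case x2: True
      show False
      proof (cases "x (p - 3)")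
        case False
        then show False
          using bound_single[of x p l] assms(4-) x1 x2 by simp
      next
        case x3: True
        obtain z0 where "z0 < p - 1" "\<not> x z0"
          using good_recurs_left[OF \<open>good x\<close>, of "p - 1"] x1 by metis
        then have "z0 < p - 3"
          using x2 x3 by (cases "z0 = p - 2"; cases "z0 = p - 3") auto
        then obtain z where z: "z0 \<le> z" "z < p - 3" "\<not> x z" "\<And>k. z < k \<Longrightarrow> k < p - 3 \<Longrightarrow> x k"
          using nearest_left[of "\<lambda>k. \<not> x k" z0 "p - 3"] \<open>\<not> x z0\<close> by metis
        have "k = p - 3 \<or> k = p - 2 \<or> k < p - 3" if "k < p - 1" for k
          using that by presburger
        then have "ones x (z + 1) (p - 1)"
          using z(4) x2 x3 unfolding ones_def by (metis add1_zle_eq)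
        then show False
          using composite[of x z p l] assms(4-) x1 z by simp
      qed
    qed
  qed
qed

section \<open>Case distinctions for runs of given parity\<close>

lemma run_one: "run x l m \<Longrightarrow> l \<le> k \<Longrightarrow> k < l + m \<Longrightarrow> x k"
  by (simp add: run_def ones_def)

lemma run_end: "run x l m \<Longrightarrow> \<not> x (l + m)"
  by (simp add: run_def)

lemma run_oddE:
  assumes "run x l m" "odd m"
  obtains "x l" "m = 1" | "x l" "m \<ge> 3"
proof -
  have "0 < m" "x l"
    using assms(1) by (auto simp: run_def ones_def)
  moreover from this have "m = 1 \<or> m \<ge> 3"
    using assms(2) by presburger
  ultimately show ?thesis
    using that by blast
qed

lemma run_evenE:
  assumes "run x l m" "even m"
  obtains "x l" "x (l + 1)" "m = 2" | "x l" "x (l + 1)" "m \<ge> 4"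
proof -
  have "0 < m"
    using assms(1) by (simp add: run_def)
  then have "m = 2 \<or> m \<ge> 4"
    using assms(2) by presburger
  moreover from this have "x l" "x (l + 1)"
    using run_one[OF assms(1)] by auto
  ultimately show ?thesis
    using that by blast
qed

lemma zeros_pair: "\<not> x a \<Longrightarrow> \<not> x (a + 1) \<Longrightarrow> zeros x a (a + 2)"
  unfolding zeros_def by (metis add1_zle_eq add.assoc less_le linorder_not_less one_add_one)

section \<open>Gaps and runs have equal parity\<close>

text \<open>The odd run keeps its start and its parity while the gap is filled from the left; a gap
  of two zeros before an odd run finally contains an excluded word.\<close>

lemma even_gap_odd_run_blocked:
  assumes "good x" "x p" "zeros x (p + 1) l" "p + 3 \<le> l" "odd (l - p)" "run x l m" "odd m"
  shows False
proof -
  \<comment> \<open>The conjunct \<open>b\<close> makes the premise \<open>near1\<close> of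
    \<open>target_blocked\<close> vacuous.\<close>
  define T where "T b l x \<longleftrightarrow> b \<and> (\<exists>m. run x l m \<and> odd m)" for b l x
  have step: "\<exists>j. (j = 0 \<or> j = 3 \<and> \<not> b) \<and> zeros (G x) l (l + j) \<and> T (b \<longleftrightarrow> even j) (l + j) (G x)"
    if x: "good x" "\<not> x (l - 2)" "\<not> x (l - 1)" "T b l x" for b l x
  proof -
    obtain m where m: "b" "run x l m" "odd m"
      using x(4) unfolding T_def by blast
    from m(2,3) obtain m' where "run (G x) l m'" "odd m'"
    proof (cases rule: run_oddE)
      case 1
      then show ?thesis
        using run1_step[OF x(1) _ x(2,3)] m that by (metis odd_one odd_numeral)
    next
      case 2
      then obtain m' where "m' = m + 2 \<or> m' = m - 2" "run (G x) l m'"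
        using run_step[OF x(1) m(2) _ x(2,3)] by metis
      then show ?thesis
        using that[of m'] m(3) by auto
    qed
    then show ?thesis
      using m(1) unfolding T_def zeros_def by (intro exI[of _ 0]) auto
  qed
  have near2: False
    if "good x" "x (p - 2) = x (p - 1)" "x p" "\<not> x (p + 1)" "\<not> x (p + 2)" "T True (p + 3) x" for p x
  proof -
    note h = that
    obtain m where m: "run x (p + 3) m" "odd m"
      using h(6) unfolding T_def by blast
    from m show False
    proof (cases rule: run_oddE)
      case 1
      then have "\<not> x (p + 4)"
        using run_end[OF m(1)] by (simp add: algebra_simps)
      then show False
        using h(2-5) 1 no_001010[OF h(1), of "p + 1"]
          no_11100100[OF h(1), of "p - 2"] no_111001011[OF h(1), of "p - 2"]
          no_00100100[OF h(1), of "p - 2"] no_001001011[OF h(1), of "p - 2"]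
        by (cases "x (p + 5)"; cases "x (p + 6)") (auto simp: algebra_simps)
    next
      case 2
      then have "x (p + 4)" "x (p + 5)"
        using run_one[OF m(1)] by auto
      then show False
        using h(2-5) 2 no_1100111[OF h(1), of "p - 1"] no_00100111[OF h(1), of "p - 2"]
        by (auto simp: algebra_simps)
    qed
  qed
  show False
    by (rule target_blocked[of T x p l, OF step _ near2]) (use assms in \<open>auto simp: T_def\<close>)
qed

text \<open>One step leads to an even gap before an odd run: for \<open>m = 2\<close> both ones
  vanish and the 1 behind them becomes the run, for larger \<open>m\<close> the pattern
  \<open>T\<^sub>11\<close> erases the first cell of the run.\<close>

lemma gap_one_even_run_blocked:
  assumes "good x" "x (p - 2)" "x (p - 1)" "x p" "\<not> x (p + 1)" "run x (p + 2) m" "even m"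
  shows False
proof -
  have x2: "x (p + 2)" "x (p + 3)" and "m = 2 \<or> m \<ge> 4"
    by (rule run_evenE[OF assms(6,7)]; simp add: add.assoc)+
  from \<open>m = 2 \<or> m \<ge> 4\<close> show False
  proof
    assume "m = 2"
    then have c: "\<not> x (p + 4)" "x (p + 5)" "\<not> x (p + 6)" "\<not> x (p + 7)"
      using run2_context[OF assms(1), of "p + 2"] assms(5,6) by (simp_all add: algebra_simps)
    have r: "run (G x) (p + 5) 1"
      using run2_step(2)[OF assms(1), of "p + 2"] assms(5,6) \<open>m = 2\<close> by (simp add: algebra_simps)
    have G: "\<not> G x (p - 1)" "\<not> G x p" "\<not> G x (p + 1)" "\<not> G x (p + 2)" "\<not> G x (p + 3)" "\<not> G x (p + 4)"
      using c x2 assms(2-5) by (auto simp: G_def flips_def algebra_simps)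
    have "k = p - 1 \<or> k = p \<or> k = p + 1 \<or> k = p + 2 \<or> k = p + 3 \<or> k = p + 4"
      if "p - 1 \<le> k" "k < p + 5" for k
      using that by presburger
    with G have z: "zeros (G x) (p - 1) (p + 5)"
      unfolding zeros_def by metis
    show False
    proof (cases "G x (p - 2)")
      case True
      then show False
        using even_gap_odd_run_blocked[OF good_G[OF assms(1)], of "p - 2" "p + 5" 1] z r by simp
    next
      case False
      \<comment> \<open>Only \<open>T\<^sub>11\<close> can erase cell \<open>p - 2\<close>, which
        determines the cells further left.\<close>
      then have x3: "\<not> x (p - 3)" "x (p - 4)" "x (p - 5)" "x (p - 6)"
        using assms(2-5) x2 by (auto simp: G_def flips_def algebra_simps)
      have G': "\<not> G x (p - 3)" "G x (p - 4)"
        using x3 assms(2-5) by (auto simp: G_def flips_def algebra_simps)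
      have "zeros (G x) (p - 3) (p + 5)"
        using z G' False zeros_Cons[of "G x" "p - 3" "p + 5"] zeros_Cons[of "G x" "p - 2" "p + 5"] by simp
      then show False
        using even_gap_odd_run_blocked[OF good_G[OF assms(1)], of "p - 4" "p + 5" 1] G' r by simp
    qed
  next
    assume m: "m \<ge> 4"
    then have x4: "x (p + 4)" "x (p + 5)"
      using run_one[OF assms(6)] by auto
    have G: "G x p" "\<not> G x (p + 1)" "\<not> G x (p + 2)" "G x (p + 3)"
      using x2 x4 assms(2-5) by (auto simp: G_def flips_def algebra_simps)
    obtain m' where m': "m' = m + 2 \<or> m' = m - 2" "ones (G x) (p + 2 + 1) (p + 2 + m')" "\<not> G x (p + 2 + m')"
      using run_tail_step[OF assms(1,6)] m by auto
    then have "run (G x) (p + 3) (m' - 1)"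
      using m by (auto simp: run_def algebra_simps)
    moreover have "zeros (G x) (p + 1) (p + 3)"
      using G zeros_pair[of "G x" "p + 1"] by (simp add: add.assoc)
    moreover have "odd (m' - 1)"
      using m'(1) assms(7) by auto
    ultimately show False
      using even_gap_odd_run_blocked[OF good_G[OF assms(1)], of p "p + 3" "m' - 1"] G by simp
  qed
qed

lemma odd_gap_even_run_blocked:
  assumes "good x" "x p" "zeros x (p + 1) l" "p + 3 \<le> l" "even (l - p)" "run x l m" "even m"
  shows False
proof -
  \<comment> \<open>Gap and run have opposite parity. This relation also survives the vanishing of a
    run of two ones, which turns an odd gap before an even run into an even gap before a single
    1.\<close>
  define T where "T b l x \<longleftrightarrow> (\<exists>m. run x l m \<and> (b \<longleftrightarrow> odd m))" for b l x
  have step: "\<exists>j. (j = 0 \<or> j = 3 \<and> \<not> b) \<and> zeros (G x) l (l + j) \<and> T (b \<longleftrightarrow> even j) (l + j) (G x)"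
    if x: "good x" "\<not> x (l - 2)" "\<not> x (l - 1)" "T b l x" for b l x
  proof -
    obtain m where m: "run x l m" "b \<longleftrightarrow> odd m"
      using x(4) unfolding T_def by blast
    consider "m = 1" | "m = 2" | "m \<ge> 3"
      using m unfolding run_def by linarith
    then show ?thesis
    proof cases
      case 1
      then have "run x l 1"
        using m by simp
      then obtain m' where m': "m' = 1 \<or> m' = 3" "run (G x) l m'"
        using run1_step[OF x(1) _ x(2,3)] by blast
      then have "odd m'"
        by auto
      then show ?thesis
        using m'(2) m(2) 1 unfolding T_def zeros_def by (intro exI[of _ 0]) auto
    next
      case 2
      then show ?thesis
        using run2_step[OF x(1) _ x(3)] m unfolding T_def by (intro exI[of _ 3]) auto
    next
      case 3
      then obtain m' where "m' = m + 2 \<or> m' = m - 2" "run (G x) l m'"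
        using run_step[OF x(1) m(1) _ x(2,3)] by metis
      then show ?thesis
        using m(2) unfolding T_def zeros_def by (intro exI[of _ 0]) auto
    qed
  qed
  have near1: False
    if "good x" "x (p - 2)" "x (p - 1)" "x p" "\<not> x (p + 1)" "T False (p + 2) x" for p x
    using gap_one_even_run_blocked[OF that(1-5)] that(6) unfolding T_def by auto
  have near2: False
    if "good x" "x (p - 2) = x (p - 1)" "x p" "\<not> x (p + 1)" "\<not> x (p + 2)" "T True (p + 3) x" for p x
  proof -
    note h = that
    obtain m where m: "run x (p + 3) m" "odd m"
      using h(6) unfolding T_def by blast
    have "zeros x (p + 1) (p + 3)"
      using h(4,5) zeros_pair[of x "p + 1"] by (simp add: add.assoc)
    with m show False
      using even_gap_odd_run_blocked[OF h(1,3), of "p + 3" m] by simp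
  qed
  show False
    by (rule target_blocked[of T x p l, OF step near1 near2]) (use assms in \<open>auto simp: T_def\<close>)
qed

text \<open>The separate 1 at \<open>l\<close> persists while \<open>m\<close> is at least 4. For
  \<open>m = 2\<close> the next step leaves four zeros between it and a single 1, an even gap before
  an odd run.\<close>

lemma odd_gap_bound_run_blocked:
  assumes "good x" "x p" "zeros x (p + 1) l" "p + 3 \<le> l" "even (l - p)"
    "x l" "\<not> x (l + 1)" "run x (l + 2) m" "even m"
  shows False
proof -
  define T where "T b l x \<longleftrightarrow> \<not> b \<and> x l \<and> \<not> x (l + 1) \<and> (\<exists>m. run x (l + 2) m \<and> even m)" for b l x
  have two: "x (l + 2)" "x (l + 3)" if "run x (l + 2) m" "even m" for x l m
    by (rule run_evenE[OF that]; simp add: add.assoc)+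
  have step: "\<exists>j. (j = 0 \<or> j = 3 \<and> \<not> b) \<and> zeros (G x) l (l + j) \<and> T (b \<longleftrightarrow> even j) (l + j) (G x)"
    if x: "good x" "\<not> x (l - 2)" "\<not> x (l - 1)" "T b l x" for b l x
  proof -
    obtain m where m: "\<not> b" "x l" "\<not> x (l + 1)" "run x (l + 2) m" "even m"
      using x(4) unfolding T_def by blast
    have G: "G x l" "\<not> G x (l + 1)"
      using m x(2,3) two[OF m(4,5)] by (auto simp: G_def flips_def algebra_simps)
    have "m = 2 \<or> m \<ge> 4"
      by (rule run_evenE[OF m(4,5)]) auto
    then show ?thesis
    proof
      assume "m = 2"
      then have "zeros (G x) (l + 2) (l + 5)" "run (G x) (l + 5) 1"
        using run2_step[OF x(1), of "l + 2"] m by (simp_all add: algebra_simps)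
      then have False
        using even_gap_odd_run_blocked[OF good_G[OF x(1)] G(1), of "l + 5" 1] zeros_Cons[of "G x" "l + 1" "l + 5"] G(2)
        by (simp add: algebra_simps)
      then show ?thesis ..
    next
      assume m4: "m \<ge> 4"
      then obtain m' where m': "m' = m + 2 \<or> m' = m - 2" "ones (G x) (l + 2 + 1) (l + 2 + m')" "\<not> G x (l + 2 + m')"
        using run_tail_step[OF x(1) m(4)] by auto
      have "x (l + 4)"
        using run_one[OF m(4)] m4 by auto
      then have "G x (l + 2)"
        using m x(2,3) two[OF m(4,5)] by (auto simp: G_def flips_def algebra_simps)
      then have "run (G x) (l + 2) m'"
        using m' m4 ones_Cons by (auto simp: run_def)
      then show ?thesis
        using m(1,5) m'(1) G unfolding T_def zeros_def by (intro exI[of _ 0]) auto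
    qed
  qed
  have near1: False
    if "good x" "x (p - 2)" "x (p - 1)" "x p" "\<not> x (p + 1)" "T False (p + 2) x" for p x
  proof -
    have "x (p + 2)" "\<not> x (p + 3)" "x (p + 4)" "x (p + 5)"
      using that(6) two[of x "p + 2"] unfolding T_def by (auto simp: add.assoc)
    then show False
      using no_101011[OF that(1), of p] that by (auto simp: algebra_simps)
  qed
  show False
    by (rule target_blocked[of T x p l, OF step near1]) (use assms in \<open>auto simp: T_def\<close>)
qed

text \<open>The number \<open>l + m - p - 1\<close> is the distance from the right end
  \<open>p\<close> to the next one.\<close>

lemma good_gap_run_even:
  assumes "good x" "x p" "zeros x (p + 1) l" "p + 2 \<le> l" "run x l m"
  shows "even (l + m - p - 1)"
proof (rule ccontr)
  assume neg: "odd (l + m - p - 1)"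
  show False
  proof (cases "p + 3 \<le> l")
    case True
    then show False
      using even_gap_odd_run_blocked[OF assms(1-3) True _ assms(5)] odd_gap_even_run_blocked[OF assms(1-3) True _ assms(5)] neg
      by (cases "even m") auto
  next
    case False
    then have l: "l = p + 2"
      using assms(4) by simp
    then have m: "even m"
      using neg by simp
    have "x l" "x (l + 1)"
      by (rule run_evenE[OF assms(5) m]; simp)+
    then have x: "\<not> x (p + 1)" "x (p + 2)" "x (p + 3)"
      using assms(3) l by (auto simp: zeros_def add.assoc)
    show False
    proof (cases "x (p - 1)")
      case True
      then show False
        using gap_one_even_run_blocked[OF assms(1), of p m] no_011011[OF assms(1), of "p - 2"] x assms(2,5) l m
        by (cases "x (p - 2)") (auto simp: algebra_simps)
    next
      \<comment> \<open>Now \<open>p\<close> is an isolated 1. The gap on its left is either even,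
        before an odd run of length 1, or odd, before a 1 bound to an even run.\<close>
      case p1: False
      then have p2: "\<not> x (p - 2)"
        using no_101011[OF assms(1), of "p - 2"] x assms(2) by (auto simp: algebra_simps)
      obtain z where "z < p" "x z"
        using good_recurs_left[OF assms(1), of p] assms(2) by metis
      then obtain q where q: "q < p" "x q" "\<And>k. q < k \<Longrightarrow> k < p \<Longrightarrow> \<not> x k"
        using nearest_left[of x z p] by metis
      have "q \<noteq> p - 1" "q \<noteq> p - 2"
        using p1 p2 q by auto
      then have "q + 3 \<le> p"
        using q(1) by simp
      moreover have "zeros x (q + 1) p"
        using q(3) by (simp add: zeros_def)
      moreover have "run x p 1"
        using assms(2) x(1) by (auto simp: run_def ones_def intro: ones_Cons)
      ultimately show False
        using even_gap_odd_run_blocked[OF assms(1) q(2), of p 1] odd_gap_bound_run_blocked[OF assms(1) q(2), of p m] assms(2,5) x l m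
        by (cases "even (p - q)") auto
    qed
  qed
qed

text \<open>If both states occur, there is a right end \<open>p\<close>, and \<open>p + n\<close> is
  one as well for an odd period \<open>n\<close>; yet stepping from each right end to the previous
  one gives an even distance.\<close>

lemma good_uniform:
  assumes "good x"
  shows "(\<forall>i. x i) \<or> (\<forall>i. \<not> x i)"
proof (rule ccontr)
  assume non: "\<not> ?thesis"
  then obtain a b where "x a" "\<not> x b"
    by blast
  obtain n where n: "odd n" "n > 0" "\<And>i. x (i - n) = x i"
    using good_period[OF assms] by blast
  have "x (a - int k * n)" for k
  proof (induction k)
    case (Suc k)
    then show ?case
      using n(3)[of "a - int k * n"] by (simp add: algebra_simps)
  qed (use \<open>x a\<close> in simp)
  moreover have "a - int (nat (a - b + 1)) * n < b"
    using mult_left_mono[of 1 n "int (nat (a - b + 1))"] n(2) by linarith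
  ultimately obtain z where "z < b" "x z"
    by blast
  then obtain p where p: "p < b" "x p" "\<And>k. p < k \<Longrightarrow> k < b \<Longrightarrow> \<not> x k"
    using nearest_left[of x z b] by metis
  then have p1: "\<not> x (p + 1)"
    using \<open>\<not> x b\<close> by (cases "p + 1 = b") auto
  have even: "even k" if "x (p + int k)" "\<not> x (p + int k + 1)" for k
    using that
  proof (induction k rule: less_induct)
    case (less k)
    show ?case
    proof (cases "k = 0")
      case False
      define q where "q = p + int k"
      have "p < q"
        using False by (simp add: q_def)
      have xq: "x q" "\<not> x (q + 1)"
        using less.prems by (auto simp: q_def)
      have "p + 1 < q"
        using \<open>p < q\<close> xq p1 by (cases "q = p + 1") auto
      then obtain z where z: "p + 1 \<le> z" "z < q" "\<not> x z" "\<And>k. z < k \<Longrightarrow> k < q \<Longrightarrow> x k"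
        using nearest_left[of "\<lambda>k. \<not> x k" "p + 1" q] p1 by metis
      obtain r where r: "p \<le> r" "r < z" "x r" "\<And>k. r < k \<Longrightarrow> k < z \<Longrightarrow> \<not> x k"
        using nearest_left[of x p z] p(2) z(1) by (metis add1_zle_eq)
      have "ones x (z + 1) (q + 1)"
        using z(4) xq(1) unfolding ones_def by (metis add1_zle_eq less_le zle_add1_eq_le)
      then have "run x (z + 1) (q - z)"
        using z(2) xq(2) by (simp add: run_def add.commute)
      moreover have "zeros x (r + 1) (z + 1)"
        using r(4) z(3) unfolding zeros_def by (metis add1_zle_eq less_le zle_add1_eq_le)
      ultimately have "even (q - r)"
        using good_gap_run_even[OF assms r(3), of "z + 1" "q - z"] r(2) by simp
      moreover have "even (nat (r - p))"
      proof (rule less.IH)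
        show "nat (r - p) < k"
          using r z by (simp add: q_def)
        have "\<not> x (r + 1)"
          using r z(3) by (cases "r + 1 = z") auto
        then show "x (p + int (nat (r - p)))" "\<not> x (p + int (nat (r - p)) + 1)"
          using r by simp_all
      qed
      ultimately show ?thesis
        using r(1) by (auto simp: q_def even_nat_iff)
    qed simp
  qed
  have "x (p + int (nat n))" "\<not> x (p + int (nat n) + 1)"
    using n(2) n(3)[of "p + n"] n(3)[of "p + n + 1"] p(2) p1 by (simp_all add: algebra_simps)
  then have "even (nat n)"
    by (rule even)
  then show False
    using n by (simp add: even_nat_iff)
qed

section \<open>Sums over a period\<close>

text \<open>Stated for cancellative monoids, to serve both weights in \<open>nat\<close> and
  parities in \<open>bit\<close>.\<close>

lemma sum_shift:
  fixes g :: "int \<Rightarrow> 'a :: cancel_comm_monoid_add"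
  assumes "\<And>i. g (i + int n) = g i"
  shows "(\<Sum>i<n. g (int i + k)) = (\<Sum>i<n. g (int i))"
proof -
  have one: "(\<Sum>i<n. h (int i + 1)) = (\<Sum>i<n. h (int i))"
    if "\<And>i. h (i + int n) = h i" for h :: "int \<Rightarrow> 'a"
  proof -
    have "h 0 + (\<Sum>i<n. h (int i + 1)) = (\<Sum>i<Suc n. h (int i))"
      by (simp only: sum.lessThan_Suc_shift) (simp add: add.commute)
    also have "\<dots> = h 0 + (\<Sum>i<n. h (int i))"
      using that[of 0] by (simp add: add.commute)
    finally show ?thesis
      by simp
  qed
  have nat: "(\<Sum>i<n. h (int i + int m)) = (\<Sum>i<n. h (int i))"
    if "\<And>i. h (i + int n) = h i" for h :: "int \<Rightarrow> 'a" and m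
  proof (induction m)
    case (Suc m)
    have "(\<Sum>i<n. h (int i + int (Suc m))) = (\<Sum>i<n. h (int i + 1 + int m))"
      by (simp add: add.assoc)
    also have "\<dots> = (\<Sum>i<n. h (int i + int m))"
      using that[of "_ + int m"] by (intro one[of "\<lambda>i. h (i + int m)"]) (simp add: algebra_simps)
    finally show ?case
      using Suc by simp
  qed simp
  show ?thesis
  proof (cases "k \<ge> 0")
    case True
    then show ?thesis
      using nat[of g "nat k"] assms by simp
  next
    case False
    have "(\<Sum>i<n. g (int i + int (nat (- k)) + k)) = (\<Sum>i<n. g (int i + k))"
      using assms[of "_ + k"] by (intro nat[of "\<lambda>i. g (i + k)"]) (simp add: algebra_simps)
    then show ?thesis
      using False by simp
  qed
qed

text \<open>Every weight has exactly one destination, and translating a summand does not change its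
  sum over a period.\<close>

lemma sum_inflow:
  assumes "shift (int n) x = x"
  shows "(\<Sum>j<n. inflow x (int j)) = (\<Sum>j<n. weight x (int j))"
proof -
  define A B C where "A p = (if fwd x p then weight x p else 0)"
    and "B p = (if \<not> fwd x p \<and> \<not> bwd x p then weight x p else 0)"
    and "C p = (if bwd x p then weight x p else 0)" for p
  have per: "weight x (p + int n) = weight x p" "fwd x (p + int n) = fwd x p" "bwd x (p + int n) = bwd x p" for p
    using weight_shift[of "int n" x p] fwd_shift[of "int n" x p] bwd_shift[of "int n" x p] assms
    by (simp_all add: add.commute)
  have "weight x p = A p + B p + C p" for p
    using bwd_not_fwd[of x p] by (auto simp: A_def B_def C_def weight_def)
  moreover have "(\<Sum>j<n. A (int j + (- 2))) = (\<Sum>j<n. A (int j))" "(\<Sum>j<n. C (int j + 2)) = (\<Sum>j<n. C (int j))"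
    by (rule sum_shift; simp add: A_def C_def per)+
  moreover have "inflow x j = A (j + (- 2)) + B j + C (j + 2)" for j
    by (simp add: inflow_def A_def B_def C_def)
  ultimately show ?thesis
    by (simp add: sum.distrib)
qed

text \<open>\<open>near_pair x i\<close> holds if cells \<open>i\<close> and \<open>i + 1\<close> are flipped together, \<open>far_pair x i\<close> if
  \<open>i\<close> and \<open>i + 3\<close> are.\<close>

definition near_pair :: "line \<Rightarrow> int \<Rightarrow> bool" where
  "near_pair x i \<longleftrightarrow>
     x (i-3) \<and> x (i-2) \<and> x (i-1) \<and> \<not> x i \<and> \<not> x (i+1) \<or>
     \<not> x (i-3) \<and> \<not> x (i-2) \<and> x (i-1) \<and> \<not> x i \<and> \<not> x (i+1) \<or>
     \<not> x (i-1) \<and> x i \<and> x (i+1) \<and> \<not> x (i+2) \<or>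
     \<not> x (i-2) \<and> \<not> x (i-1) \<and> x i \<and> \<not> x (i+1) \<and> x (i+2) \<and> \<not> x (i+3) \<or>
     x (i-1) \<and> x i \<and> x (i+1) \<and> \<not> x (i+2) \<and> x (i+3) \<and> x (i+4) \<and> \<not> x (i+5)"

definition far_pair :: "line \<Rightarrow> int \<Rightarrow> bool" where
  "far_pair x i \<longleftrightarrow> x (i-1) \<and> x i \<and> x (i+1) \<and> \<not> x (i+2) \<and> x (i+3) \<and> \<not> (x (i+4) \<and> \<not> x (i+5))"

lemma near_pair_shift: "near_pair (shift p x) k = near_pair x (p + k)"
  by (simp add: near_pair_def shift_def algebra_simps)

lemma far_pair_shift: "far_pair (shift p x) k = far_pair x (p + k)"
  by (simp add: far_pair_def shift_def algebra_simps)

lemma flips_shift: "flips (shift p x) k = flips x (p + k)"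
  by (simp add: flips_def shift_def algebra_simps)

text \<open>The near pairs are \<open>T\<^sub>1\<close> with \<open>T\<^sub>2\<close>,
  \<open>T\<^sub>3\<close> with \<open>T\<^sub>4\<close>, \<open>T\<^sub>5\<close> with
  \<open>T\<^sub>6\<close>, \<open>T\<^sub>8\<close> with \<open>T\<^sub>7\<close>, and
  \<open>T\<^sub>9\<close> with \<open>T\<^sub>12\<close>; the far pairs are
  \<open>T\<^sub>9\<close> with \<open>T\<^sub>10\<close> or \<open>T\<^sub>11\<close>.\<close>

lemma flips_pairs0:
  "(of_bool (flips x 0) :: bit) = of_bool (near_pair x 0) + of_bool (near_pair x (-1))
     + of_bool (far_pair x 0) + of_bool (far_pair x (-3))"
  by (cases "x 0"; cases "x 1"; cases "x 2"; cases "x (-1)"; cases "x (-2)"; cases "x 3"; cases "x 4";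
      simp add: flips_def near_pair_def far_pair_def)

text \<open>Each pair is counted at both of its cells and cancels modulo 2.\<close>

lemma sum_flips:
  assumes "shift (int n) x = x"
  shows "(\<Sum>i<n. (of_bool (flips x (int i)) :: bit)) = 0"
proof -
  define N F where "N i = (of_bool (near_pair x i) :: bit)" and "F i = (of_bool (far_pair x i) :: bit)" for i
  have "of_bool (flips x i) = N i + N (i + (- 1)) + F i + F (i + (- 3))" for i
    using flips_pairs0[of "shift i x"] unfolding flips_shift near_pair_shift far_pair_shift N_def F_def by simp
  moreover have "(\<Sum>j<n. N (int j + (- 1))) = (\<Sum>j<n. N (int j))" "(\<Sum>j<n. F (int j + (- 3))) = (\<Sum>j<n. F (int j))"
    using near_pair_shift[of "int n" x] far_pair_shift[of "int n" x] assms
    by (intro sum_shift; simp add: N_def F_def add.commute)+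
  moreover have "a + a + b + b = 0" for a b :: bit
    by simp
  ultimately show ?thesis
    by (simp only: sum.distrib)
qed

section \<open>Configurations\<close>

definition line :: "config \<Rightarrow> line" where
  "line c = (\<lambda>i. cell c i = 1)"

lemma shift_line: "shift (int (length c)) (line c) = line c"
  by (simp add: shift_def line_def cell_def)

lemma upto_window: "[- 4..4] = [- 4, - 3, - 2, - 1, 0, 1, 2, 3, 4 :: int]"
  by (simp add: upto_rec1)

lemma f_window:
  assumes "x (- 4) = (a0 = 1)" "x (- 3) = (a1 = 1)" "x (- 2) = (a2 = 1)" "x (- 1) = (a3 = 1)" "x 0 = (a4 = 1)"
    "x 1 = (a5 = 1)" "x 2 = (a6 = 1)" "x 3 = (a7 = 1)" "x 4 = (a8 = 1)"
  shows "f [a0, a1, a2, a3, a4, a5, a6, a7, a8] = a4 + of_bool (flips x 0)"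
proof -
  have "1 - a = a + 1" for a :: bit
    by (cases a) simp_all
  moreover have "(\<exists>p\<in>active_patterns. matches [a0, a1, a2, a3, a4, a5, a6, a7, a8] p) \<longleftrightarrow> flips x 0"
    by (simp add: active_patterns_def matches_def flips_def assms conj_ac)
  ultimately show ?thesis
    by (simp add: f_def)
qed

lemma cell_F:
  assumes "c \<noteq> []"
  shows "cell (F c) i = cell c i + of_bool (flips (line c) i)"
proof -
  let ?k = "i mod int (length c)"
  have k: "0 \<le> ?k" "nat ?k < length c"
    using assms by (simp_all add: nat_less_iff)
  have mod: "cell c (?k + d) = cell c (i + d)" for d
    by (simp add: cell_def mod_add_left_eq)
  have "cell (F c) i = f (map (\<lambda>d. cell c (i + d)) [- 4..4])"
    using k mod by (simp add: cell_def F_def del: upto_rec_numeral)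
  also have "\<dots> = cell c i + of_bool (flips (line c) i)"
    using flips_shift[of i "line c" 0]
    by (simp only: upto_window list.map) (subst f_window[of "shift i (line c)"]; simp add: shift_def line_def)
  finally show ?thesis .
qed

lemma line_F:
  assumes "c \<noteq> []"
  shows "line (F c) = G (line c)"
proof
  fix i
  show "line (F c) i = G (line c) i"
    using cell_F[OF assms, of i] by (cases "cell c i") (simp_all add: G_def line_def)
qed

lemma Par_eq: "Par c = (\<Sum>i<length c. cell c (int i))"
  by (simp add: Par_def cell_def)

lemma Par_F:
  assumes "c \<noteq> []"
  shows "Par (F c) = Par c"
  using sum_flips[OF shift_line[of c]] by (simp only: Par_eq length_F cell_F[OF assms] sum.distrib add_0_right)

section \<open>The total weight as a potential\<close>

definition potential :: "config \<Rightarrow> nat" where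
  "potential c = (\<Sum>j<length c. weight (line c) (int j))"

lemma potential_F_le:
  assumes "c \<noteq> []"
  shows "potential (F c) \<le> potential c"
  unfolding potential_def length_F line_F[OF assms] sum_inflow[OF shift_line, symmetric]
  by (intro sum_mono weight_G_le)

text \<open>Equal sums of termwise ordered families agree termwise on one period; translation by
  multiples of the length reaches all cells.\<close>

lemma potential_F_eq:
  assumes "c \<noteq> []" "potential (F c) = potential c"
  shows "weight (G (line c)) j = inflow (line c) j"
proof -
  let ?x = "line c" and ?n = "int (length c)"
  have "(\<Sum>j<length c. weight (G ?x) (int j)) = (\<Sum>j<length c. inflow ?x (int j))"
    using assms(2) by (simp add: potential_def line_F[OF assms(1)] sum_inflow[OF shift_line])
  then have eq: "weight (G ?x) (int i) = inflow ?x (int i)" if "i < length c" for i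
    using sum_mono_inv[of "\<lambda>i. weight (G ?x) (int i)" "{..<length c}" "\<lambda>i. inflow ?x (int i)" i]
      weight_G_le that by simp
  have shift: "shift (k * ?n) ?x = ?x" for k
    by (simp add: shift_def line_def cell_def)
  have "weight (G ?x) (j mod ?n) = inflow ?x (j mod ?n)"
    using eq[of "nat (j mod ?n)"] assms(1) by (simp add: nat_less_iff)
  moreover have "j = j div ?n * ?n + j mod ?n"
    by simp
  ultimately show ?thesis
    using shift[of "j div ?n"] G_shift[of "j div ?n * ?n" ?x]
      weight_shift[of "j div ?n * ?n" "G ?x" "j mod ?n"] inflow_shift[of "j div ?n * ?n" ?x "j mod ?n"]
    by metis
qed

lemma length_iterate: "length ((F ^^ t) c) = length c"
  by (induction t) simp_all

lemma line_iterate: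
  assumes "c \<noteq> []"
  shows "line ((F ^^ t) c) = (G ^^ t) (line c)"
proof (induction t)
  case (Suc t)
  have "(F ^^ t) c \<noteq> []"
    using assms length_iterate[of t c] by force
  then show ?case
    using Suc by (simp add: line_F)
qed simp

text \<open>A nonincreasing sequence of natural numbers is constant once its minimum is
  attained.\<close>

lemma potential_eventually_constant:
  assumes "c \<noteq> []"
  obtains t0 where "\<And>t. potential ((F ^^ t) ((F ^^ t0) c)) = potential ((F ^^ t0) c)"
proof -
  have ne: "(F ^^ t) c \<noteq> []" for t
    using assms length_iterate[of t c] by force
  have anti: "potential ((F ^^ (t + s)) c) \<le> potential ((F ^^ s) c)" for t s
  proof (induction t)
    case (Suc t)
    then show ?case
      using potential_F_le[OF ne[of "t + s"]] by simp
  qed simp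
  obtain t0 where "\<And>t. potential ((F ^^ t0) c) \<le> potential ((F ^^ t) c)"
    using ex_has_least_nat[of "\<lambda>_. True" 0 "\<lambda>t. potential ((F ^^ t) c)"] by blast
  then have "potential ((F ^^ (t + t0)) c) = potential ((F ^^ t0) c)" for t
    using anti[of t t0] by (simp add: le_antisym)
  then show ?thesis
    using that[of t0] by (simp add: funpow_add)
qed

lemma constant_potential_good:
  assumes "odd (length c)" "\<And>t. potential ((F ^^ t) c) = potential c"
  shows "good (line c)"
proof -
  have c: "c \<noteq> []"
    using assms(1) by auto
  have "weight ((G ^^ Suc t) (line c)) j = inflow ((G ^^ t) (line c)) j" for t j
  proof -
    have ne: "(F ^^ t) c \<noteq> []"
      using c length_iterate[of t c] by force
    show ?thesis
      using potential_F_eq[OF ne] assms(2)[of t] assms(2)[of "Suc t"] line_iterate[OF c] by simp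
  qed
  moreover have "odd (int (length c)) \<and> int (length c) > 0 \<and> shift (int (length c)) (line c) = line c"
    using assms(1) c shift_line by simp
  ultimately show ?thesis
    unfolding good_def by blast
qed

lemma uniform_replicate:
  assumes "\<And>i. cell c i = b"
  shows "c = replicate (length c) b"
proof (rule nth_equalityI)
  fix i assume "i < length c"
  then show "c ! i = replicate (length c) b ! i"
    using assms[of "int i"] by (simp add: cell_def)
qed simp

lemma cell_replicate: "n > 0 \<Longrightarrow> cell (replicate n b) i = b"
  by (simp add: cell_def nat_less_iff)

lemma F_replicate: "F (replicate n b) = replicate n b"
proof (cases "n = 0")
  case False
  then have "cell (F (replicate n b)) i = b" for i
    by (cases b) (simp_all add: cell_F cell_replicate flips_def line_def)
  then show ?thesis
    using uniform_replicate[of "F (replicate n b)" b] by simp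
qed (simp add: F_def)

lemma Par_iterate:
  assumes "c \<noteq> []"
  shows "Par ((F ^^ t) c) = Par c"
proof (induction t)
  case (Suc t)
  have "(F ^^ t) c \<noteq> []"
    using assms length_iterate[of t c] by force
  then show ?case
    using Suc by (simp add: Par_F)
qed simp

lemma Par_replicate: "odd n \<Longrightarrow> Par (replicate n b) = b"
  by (cases b) (auto simp: Par_def elim!: oddE)

theorem theorem3:
  shows "\<forall>x\<in>X_odd. \<exists>t0\<ge>0. \<forall>t\<ge>t0.
    homogeneous ((F ^^ t) x)
    \<and> (Par x = 1 \<longrightarrow> (F ^^ t) x = replicate (length x) 1)
    \<and> (Par x = 0 \<longrightarrow> (F ^^ t) x = replicate (length x) 0)"
proof
  fix x assume "x \<in> X_odd"
  then have odd: "odd (length x)" and ne: "x \<noteq> []"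
    by (auto simp: X_odd_iff)
  obtain t0 where t0: "\<And>t. potential ((F ^^ t) ((F ^^ t0) x)) = potential ((F ^^ t0) x)"
    using potential_eventually_constant[OF ne] by blast
  define y where "y = (F ^^ t0) x"
  have "good (line y)"
    using constant_potential_good[of y] odd t0 by (simp add: y_def length_iterate)
  then obtain b where "\<And>i. cell y i = b"
    using good_uniform[of "line y"] by (auto simp: line_def)
  then have y: "y = replicate (length x) b"
    using uniform_replicate[of y b] by (simp add: y_def length_iterate)
  \<comment> \<open>Parity is invariant, and an odd number of copies of \<open>b\<close> has parity
    \<open>b\<close>.\<close>
  have b: "b = Par x"
    using Par_iterate[OF ne, of t0] y odd by (simp add: Par_replicate y_def)
  have "(F ^^ t) x = replicate (length x) b" if "t \<ge> t0" for t
  proof -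
    have "(F ^^ k) y = y" for k
      by (induction k) (simp_all add: y F_replicate)
    moreover have "(F ^^ t) x = (F ^^ (t - t0)) y"
      using fun_cong[OF funpow_add[of "t - t0" t0 F], of x] that by (simp add: y_def)
    ultimately show ?thesis
      using y by simp
  qed
  then show "\<exists>t0\<ge>0. \<forall>t\<ge>t0. homogeneous ((F ^^ t) x)
    \<and> (Par x = 1 \<longrightarrow> (F ^^ t) x = replicate (length x) 1)
    \<and> (Par x = 0 \<longrightarrow> (F ^^ t) x = replicate (length x) 0)"
    using b by (intro exI[of _ t0]) (cases b; auto simp: homogeneous_def)
qed

end
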